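(* Let $Q=[Q_{i,j}]$ be a random symmetric $n\times n$ matrix whose entries $Q_{i,j}$, $1\le i\le j\le n$, are i.i.d. with a continuous cumulative distribution function $F$, and let $K_n$ be the support size of a global minimizer $\mathbf X^*$ of $\mathbf x^TQ\mathbf x$ over the standard simplex $\Delta_n$. Suppose that the distribution is supported by $(-\infty,B)$, $B\le\infty$, and that, for some real $a, x_0$ and some $b,c,r,\kappa>0$, $$F(x)=(c+O(|x|^{-\kappa}))\,|x|^a\exp(-r|x-x_0|^b),\qquad x\to-\infty .$$ Let $b>1$. Then, for all $k\le k_n$, $$\Pr\{K_n\ge k\}\le_b n\left(\frac89\right)^{k/4}+n\exp\left(-\frac{k\left(\log\frac nk\right)^{\min\{0,a/b\}}}{2e}\right).$$ Consequently $K_n=O_p(\log n)$ for $a\ge0$, and $K_n=O_p\bigl((\log n)^{1+|a|/b}\bigr)$ for $a<0$.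
   Context: $\Delta_n=\{\mathbf x\in\mathbb R^n:\ \mathbf x\ge \mathbf 0,\ \sum_{j}x_j=1\}$. $\mathbf X^*$ denotes a global minimum solution of the problem of minimizing $\mathbf x^TQ\mathbf x$ over $\Delta_n$, and $K_n=|\{j\in[n]: X^*_j>0\}|$. $k_n=\lceil\alpha n^{1/2}\rceil$, where $\alpha>e\sqrt2$ is a fixed constant. By shifting and scaling, the paper takes $r=1$, $x_0=0$. The symbol $L\le_b R$ means that $L$ is at most $R$ times a bounded coefficient, i.e. $L=O(R)$, as $n\to\infty$, uniformly over the stated range of $k$. $K_n=O_p(g(n))$ means that $\Pr(K_n>\omega(n)g(n))\to0$ for every $\omega(n)\to\infty$, however slowly. *)

theory Defs
  imports "HOL-Probability.Probability" "HOL-Library.Landau_Symbols"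
begin

text \<open>
  The dimension tends to infinity, so vectors in \<open>\<real>\<^sup>n\<close> are functions on the index set
  \<open>{1..n}\<close> (with \<open>undefined\<close> outside of it), i.e. points of
  \<open>\<Pi>\<^sub>M j\<in>{1..n}. borel\<close>.
\<close>

definition std_simplex :: "nat \<Rightarrow> (nat \<Rightarrow> real) set" where
  "std_simplex n = {x \<in> {1..n} \<rightarrow>\<^sub>E UNIV. (\<forall>j\<in>{1..n}. 0 \<le> x j) \<and> (\<Sum>j=1..n. x j) = 1}"

definition quad_form :: "nat \<Rightarrow> (nat \<Rightarrow> nat \<Rightarrow> real) \<Rightarrow> (nat \<Rightarrow> real) \<Rightarrow> real" where
  "quad_form n A x = (\<Sum>i=1..n. \<Sum>j=1..n. x i * A i j * x j)"

definition StQP_minimizer :: "nat \<Rightarrow> (nat \<Rightarrow> nat \<Rightarrow> real) \<Rightarrow> (nat \<Rightarrow> real) \<Rightarrow> bool" where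
  "StQP_minimizer n A x \<longleftrightarrow> is_arg_min (quad_form n A) (\<lambda>y. y \<in> std_simplex n) x"

definition support_size :: "nat \<Rightarrow> (nat \<Rightarrow> real) \<Rightarrow> nat" where
  "support_size n x = card {j \<in> {1..n}. x j > 0}"

definition iid_symmetric_matrix ::
    "'w measure \<Rightarrow> real measure \<Rightarrow> nat \<Rightarrow> (nat \<Rightarrow> nat \<Rightarrow> 'w \<Rightarrow> real) \<Rightarrow> bool" where
  "iid_symmetric_matrix M D n Q \<longleftrightarrow>
     (\<forall>\<omega>\<in>space M. \<forall>i\<in>{1..n}. \<forall>j\<in>{1..n}. Q i j \<omega> = Q j i \<omega>) \<and>
     prob_space.indep_vars M (\<lambda>_. borel) (\<lambda>(i, j). Q i j) {(i, j). 1 \<le> i \<and> i \<le> j \<and> j \<le> n} \<and>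
     (\<forall>i j. 1 \<le> i \<and> i \<le> j \<and> j \<le> n \<longrightarrow> distr M borel (Q i j) = D)"

text \<open>
  A measurable selection of minimizers: measurability makes \<open>{K\<^sub>n \<ge> k}\<close> an event.
\<close>

definition random_minimizer ::
    "'w measure \<Rightarrow> nat \<Rightarrow> (nat \<Rightarrow> nat \<Rightarrow> 'w \<Rightarrow> real) \<Rightarrow> ('w \<Rightarrow> nat \<Rightarrow> real) \<Rightarrow> bool" where
  "random_minimizer M n Q X \<longleftrightarrow>
     X \<in> M \<rightarrow>\<^sub>M (\<Pi>\<^sub>M j\<in>{1..n}. borel) \<and>
     (\<forall>\<omega>\<in>space M. StQP_minimizer n (\<lambda>i j. Q i j \<omega>) (X \<omega>))"

definition k_max :: "real \<Rightarrow> nat \<Rightarrow> nat" where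
  "k_max \<alpha> n = nat \<lceil>\<alpha> * sqrt (real n)\<rceil>"

text \<open>
  \<open>K\<^sub>n = O\<^sub>p(g(n))\<close>, where \<open>K\<^sub>n\<close> lives on its own probability space \<open>M n\<close>.
\<close>

definition bigo_in_prob ::
    "(nat \<Rightarrow> 'w measure) \<Rightarrow> (nat \<Rightarrow> 'w \<Rightarrow> nat) \<Rightarrow> (nat \<Rightarrow> real) \<Rightarrow> bool" where
  "bigo_in_prob M K g \<longleftrightarrow>
     (\<forall>w :: nat \<Rightarrow> real. filterlim w at_top sequentially \<longrightarrow>
        (\<lambda>n. measure (M n) {\<omega> \<in> space (M n). real (K n \<omega>) > w n * g n}) \<longlonglongrightarrow> 0)"

end

theory Submission
  imports Defs "HOL-Real_Asymp.Real_Asymp"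
begin

text \<open>
  Let \<open>x\<close> be a minimizer with support \<open>S\<close> and value \<open>v\<close>, and let \<open>K = card S\<close>. The first-order
  condition bounds every row average \<open>\<Sum>\<^sub>j A\<^sub>i\<^sub>j x\<^sub>j\<close>, \<open>i \<in> S\<close>, by \<open>v\<close>. Averaging these bounds over
  \<open>i \<in> S\<close> \<^emph>\<open>with equal weights\<close> and exchanging the sums shows that the \<open>x\<close>-weighted mean of the column
  averages over \<open>S\<close> is at most \<open>v\<close>, so some single column \<open>j \<in> S\<close> has \<open>\<Sum>\<^bsub>i\<in>S\<^esub> A\<^sub>i\<^sub>j \<le> K v\<close>. On the other
  hand \<open>v\<close> is at most every diagonal entry, because the vertices of the simplex compete. Hence, if
  some diagonal entry is \<open>\<le> t\<close> and \<open>t \<le> u\<close>, then the excess \<open>\<Sum>\<^bsub>i\<noteq>j\<^esub> (u - A\<^sub>i\<^sub>j)\<^sup>+\<close> below the level \<open>u\<close>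
  in some column \<open>j\<close> is at least \<open>(K - 1) (u - t)\<close> (\<open>minimizer_column_excess\<close>). The point is that only \<open>n\<close>
  columns have to be examined, not all possible supports, and that no weights are left.

  To see that a large excess is unlikely, take \<open>u\<close> with \<open>F u = k / (2 n)\<close>, so that about \<open>k / 2\<close> entries
  of a column lie below \<open>u\<close>. For a tail \<open>\<bar>x\<bar>\<^sup>a exp (- r \<bar>x\<bar>\<^sup>b)\<close> with \<open>b > 1\<close> the function \<open>- log F\<close> has slope
  about \<open>r b \<bar>u\<bar>\<^bsup>b-1\<^esup>\<close> at \<open>u\<close> and becomes steeper to the left. Let \<open>\<rho>\<close> be three quarters of this slope. Then
  the excess \<open>u - q\<close> of an entry below \<open>u\<close> has, up to a constant factor, a lighter tail than an exponential
  variable of rate \<open>\<rho>\<close>, while going from \<open>u\<close> to the left by a multiple of \<open>1/\<rho>\<close> costs only a constant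
  factor of \<open>F\<close> (\<open>cdf_tail_regular\<close>). For \<open>t = u - 3 / (2 \<rho>)\<close> the probability that all \<open>n\<close> diagonal
  entries exceed \<open>t\<close> is at most \<open>exp (- n F t)\<close>, which is exponentially small in \<open>k\<close>, and so is the Chernoff
  bound for the excess in each column (\<open>excess_mgf_le\<close>, \<open>iid_excess_tail\<close>). The constants are such
  that the total is at most \<open>4 n (8/9)\<^bsup>k/4\<^esup>\<close> (\<open>support_size_tail\<close>, \<open>support_size_tail_bound_le\<close>).

  Taking \<open>k\<close> a multiple of \<open>log n\<close> in this estimate gives \<open>K\<^sub>n = O\<^sub>p(log n)\<close>, and
  \<open>log n \<le> (log n)\<^bsup>1 + \<bar>a\<bar>/b\<^esup>\<close> for \<open>n \<ge> 3\<close>.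
\<close>

section \<open>A column of small sum over the support of a minimizer\<close>

text \<open>
  First-order optimality. Since \<open>x i > 0\<close>, one can move from \<open>x\<close> a little \<^emph>\<open>away\<close> from the \<open>i\<close>-th vertex
  without leaving the simplex; the value cannot drop to first order, which is the claim.
\<close>

lemma minimizer_row_le:
  assumes minim: "StQP_minimizer n A x"
    and sym: "\<And>i j. i \<in> {1..n} \<Longrightarrow> j \<in> {1..n} \<Longrightarrow> A i j = A j i"
    and i: "i \<in> {1..n}" and pos: "x i > 0"
  shows "(\<Sum>j=1..n. A i j * x j) \<le> quad_form n A x"
proof -
  define val where "val = quad_form n A x"
  define R where "R = (\<Sum>j=1..n. A i j * x j)"
  have x: "x \<in> std_simplex n" and min: "\<And>y. y \<in> std_simplex n \<Longrightarrow> val \<le> quad_form n A y"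
    using minim by (auto simp: StQP_minimizer_def is_arg_min_linorder val_def)
  have R': "(\<Sum>k=1..n. x k * A k i) = R"
    unfolding R_def by (intro sum.cong) (use sym i in auto)
  have key: "2 * (R - val) \<le> e * (val - 2 * R + A i i)" if e: "0 < e" "e \<le> x i" for e
  proof -
    define d where "d k = (if k = i then 1 else 0 :: real)" for k
    have pick_right: "(\<Sum>l=1..n. g l * d l) = g i" and pick_left: "(\<Sum>l=1..n. d l * g l) = g i"
      for g :: "nat \<Rightarrow> real"
      using i by (simp_all add: d_def if_distrib[of "\<lambda>y. _ * y"] if_distrib[of "\<lambda>y. y * _"]
          sum.delta cong: if_cong)
    \<comment> \<open>The competitor is \<open>x + e (x - d)\<close>, where \<open>d\<close> is the \<open>i\<close>-th vertex.\<close>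
    define z where "z = (\<lambda>k. if k \<in> {1..n} then (1 + e) * x k - e * d k else undefined)"
    have "0 \<le> z k" if "k \<in> {1..n}" for k
      using that x e by (auto simp: z_def d_def std_simplex_def algebra_simps intro!: add_increasing2)
    moreover have "(\<Sum>k=1..n. z k) = (1 + e) * (\<Sum>k=1..n. x k) - e * (\<Sum>k=1..n. d k)"
      by (simp add: z_def sum_subtractf sum_distrib_left)
    ultimately have "z \<in> std_simplex n"
      using x i by (auto simp: std_simplex_def d_def z_def sum.delta)
    from min[OF this] have "val \<le> quad_form n A z" .
    also have "quad_form n A z =
        (\<Sum>k=1..n. \<Sum>l=1..n. (1+e)^2 * (x k * A k l * x l)
           - (1+e) * e * (x k * (A k l * d l)) - (1+e) * e * (d k * (A k l * x l))
           + e^2 * (d k * (A k l * d l)))"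
      unfolding quad_form_def by (intro sum.cong refl) (simp add: z_def algebra_simps power2_eq_square)
    also have "\<dots> = (1+e)^2 * val - (1+e) * e * (\<Sum>k=1..n. x k * (\<Sum>l=1..n. A k l * d l))
        - (1+e) * e * (\<Sum>k=1..n. d k * (\<Sum>l=1..n. A k l * x l))
        + e^2 * (\<Sum>k=1..n. d k * (\<Sum>l=1..n. A k l * d l))"
      unfolding val_def quad_form_def by (simp add: sum.distrib sum_subtractf sum_distrib_left)
    also have "\<dots> = (1+e)^2 * val - 2 * (1+e) * e * R + e^2 * A i i"
      unfolding pick_right pick_left R' R_def[symmetric] by (simp add: algebra_simps)
    finally have "e * (2 * (R - val)) \<le> e * (e * (val - 2 * R + A i i))"
      by (simp add: algebra_simps power2_eq_square)
    thus ?thesis using e by simp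
  qed
  have "R - val \<le> 0"
  proof (rule ccontr)
    assume "\<not> R - val \<le> 0"
    hence g: "R - val > 0" by simp
    define c where "c = val - 2 * R + A i i"
    \<comment> \<open>Small enough for the second-order term in \<open>key\<close> to stay below the first-order one.\<close>
    define e where "e = min (x i) ((R - val) / (\<bar>c\<bar> + 1))"
    have e: "0 < e" "e \<le> x i" using g pos by (auto simp: e_def)
    have "e * c \<le> e * (\<bar>c\<bar> + 1)" using e by (intro mult_left_mono) auto
    also have "\<dots> \<le> ((R - val) / (\<bar>c\<bar> + 1)) * (\<bar>c\<bar> + 1)"
      by (intro mult_right_mono) (auto simp: e_def)
    also have "\<dots> = R - val" by simp
    finally show False using key[OF e] g by (simp add: c_def)
  qed
  thus ?thesis by (simp add: R_def val_def)
qed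

text \<open>The value at the \<open>l\<close>-th vertex of the simplex is \<open>A l l\<close>.\<close>

lemma minimizer_le_diag:
  assumes minim: "StQP_minimizer n A x" and l: "l \<in> {1..n}"
  shows "quad_form n A x \<le> A l l"
proof -
  define z where "z = (\<lambda>k. if k \<in> {1..n} then (if k = l then 1 else 0) else undefined :: real)"
  have "z \<in> std_simplex n" using l by (auto simp: std_simplex_def z_def sum.delta)
  hence "quad_form n A x \<le> quad_form n A z"
    using minim by (auto simp: StQP_minimizer_def is_arg_min_linorder)
  also have "quad_form n A z = (\<Sum>k=1..n. (if k = l then 1 else 0) * (\<Sum>j=1..n. A k j * (if j = l then 1 else 0)))"
    unfolding quad_form_def sum_distrib_left by (intro sum.cong refl) (auto simp: z_def)
  also have "\<dots> = A l l"
    using l by (simp add: if_distrib[of "\<lambda>y. _ * y"] if_distrib[of "\<lambda>y. y * _"] sum.delta cong: if_cong)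
  finally show ?thesis .
qed

text \<open>
  Summing the first-order conditions over \<open>i \<in> S\<close> with equal weights gives
  \<open>\<Sum>\<^bsub>j\<in>S\<^esub> x\<^sub>j (\<Sum>\<^bsub>i\<in>S\<^esub> A\<^sub>i\<^sub>j) \<le> card S * v\<close>. The left side is an average over \<open>j\<close>, so it has a term
  that does not exceed the right side, and this term no longer involves \<open>x\<close>.
\<close>

lemma minimizer_light_column:
  assumes minim: "StQP_minimizer n A x"
    and sym: "\<And>i j. i \<in> {1..n} \<Longrightarrow> j \<in> {1..n} \<Longrightarrow> A i j = A j i"
  defines "S \<equiv> {j \<in> {1..n}. x j > 0}"
  obtains j where "j \<in> S" "(\<Sum>i\<in>S. A i j) \<le> real (card S) * quad_form n A x"
proof -
  define val where "val = quad_form n A x"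
  have x: "x \<in> std_simplex n"
    using minim by (auto simp: StQP_minimizer_def is_arg_min_linorder)
  have fin: "finite S" and S: "S \<subseteq> {1..n}" by (auto simp: S_def)
  have out: "x j = 0" if "j \<in> {1..n} - S" for j
    using that x by (force simp: S_def std_simplex_def)
  have row: "(\<Sum>j\<in>S. A i j * x j) \<le> val" if "i \<in> S" for i
  proof -
    have "(\<Sum>j\<in>S. A i j * x j) = (\<Sum>j=1..n. A i j * x j)"
      by (rule sum.mono_neutral_left) (use S out in auto)
    thus ?thesis using minimizer_row_le[OF minim sym, of i] that by (simp add: S_def val_def)
  qed
  have sum1: "(\<Sum>j\<in>S. x j) = 1"
  proof -
    have "(\<Sum>j\<in>S. x j) = (\<Sum>j=1..n. x j)"
      by (rule sum.mono_neutral_left) (use S out in auto)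
    thus ?thesis using x by (simp add: std_simplex_def)
  qed
  have "\<exists>j\<in>S. (\<Sum>i\<in>S. A i j) \<le> real (card S) * val"
  proof (rule ccontr)
    assume "\<not> ?thesis"
    hence gt: "real (card S) * val < (\<Sum>i\<in>S. A i j)" if "j \<in> S" for j using that by (auto simp: not_le)
    have "S \<noteq> {}" using sum1 by auto
    have "real (card S) * val = (\<Sum>j\<in>S. real (card S) * val * x j)"
      using sum1 by (simp flip: sum_distrib_left)
    also have "\<dots> < (\<Sum>j\<in>S. (\<Sum>i\<in>S. A i j) * x j)"
      using gt fin \<open>S \<noteq> {}\<close> by (intro sum_strict_mono mult_strict_right_mono) (auto simp: S_def)
    also have "\<dots> = (\<Sum>i\<in>S. \<Sum>j\<in>S. A i j * x j)"
      unfolding sum_distrib_right by (rule sum.swap)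
    also have "\<dots> \<le> (\<Sum>i\<in>S. val)" by (rule sum_mono) (rule row)
    finally show False by simp
  qed
  thus thesis using that by (auto simp: val_def)
qed

text \<open>
  The diagonal term of the light column is at least the optimal value, so the remaining
  \<open>card S - 1\<close> terms still have mean at most that value. Replacing \<open>u - A i j\<close> by its positive part allows
  extending the sum from the unknown set \<open>S\<close> to the whole column.
\<close>

lemma minimizer_column_excess:
  assumes minim: "StQP_minimizer n A x"
    and sym: "\<And>i j. i \<in> {1..n} \<Longrightarrow> j \<in> {1..n} \<Longrightarrow> A i j = A j i"
    and k: "k \<le> support_size n x"
    and l: "l \<in> {1..n}" "A l l \<le> t" and tu: "t \<le> u"
  obtains j where "j \<in> {1..n}"
    "(real k - 1) * (u - t) \<le> (\<Sum>i\<in>{1..n} - {j}. max 0 (u - A i j))"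
proof -
  define val where "val = quad_form n A x"
  define S where "S = {j \<in> {1..n}. x j > 0}"
  obtain j where j: "j \<in> S" and light: "(\<Sum>i\<in>S. A i j) \<le> real (card S) * val"
    using minimizer_light_column[OF minim sym] unfolding S_def val_def by blast
  have fin: "finite S" by (simp add: S_def)
  have jn: "j \<in> {1..n}" using j by (simp add: S_def)
  have lt: "val \<le> t" using minimizer_le_diag[OF minim l(1)] l(2) by (simp add: val_def)
  have lj: "val \<le> A j j" using minimizer_le_diag[OF minim jn] by (simp add: val_def)
  have cS: "card S \<ge> 1" using j fin by (auto simp: Suc_le_eq card_gt_0_iff)
  have card: "real (card (S - {j})) = real (card S) - 1"
    using j fin cS by (simp add: of_nat_diff)
  have off: "(\<Sum>i\<in>S - {j}. A i j) \<le> (real (card S) - 1) * val"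
    using light lj sum.remove[OF fin j, of "\<lambda>i. A i j"] by (simp add: algebra_simps)
  have "(real k - 1) * (u - t) \<le> (real (card S) - 1) * (u - val)"
    using k cS lt tu by (intro mult_mono) (auto simp: support_size_def S_def)
  also have "\<dots> \<le> (\<Sum>i\<in>S - {j}. u - A i j)"
    using off by (simp add: sum_subtractf card algebra_simps)
  also have "\<dots> \<le> (\<Sum>i\<in>S - {j}. max 0 (u - A i j))" by (rule sum_mono) simp
  also have "\<dots> \<le> (\<Sum>i\<in>{1..n} - {j}. max 0 (u - A i j))"
    by (rule sum_mono2) (auto simp: S_def)
  finally show thesis using that jn by blast
qed

section \<open>Exponential moments of the excess below a level\<close>

lemma layer_cake_exp:
  fixes s z :: real assumes s: "s > 0"
  shows "ennreal (exp (s * max 0 z))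
    = 1 + (\<integral>\<^sup>+y. ennreal (s * exp (s * y)) * indicator {0..} y * indicator {..z} y \<partial>lborel)"
proof (cases "z \<ge> 0")
  case True
  have "(\<integral>\<^sup>+y. ennreal (s * exp (s * y)) * indicator {0..} y * indicator {..z} y \<partial>lborel)
      = (\<integral>\<^sup>+y. ennreal (s * exp (s * y)) * indicator {0..z} y \<partial>lborel)"
    by (intro nn_integral_cong) (auto simp: indicator_def)
  also have "\<dots> = ennreal (exp (s * z) - exp (s * 0))"
    by (rule nn_integral_FTC_Icc[where F = "\<lambda>y. exp (s * y)"])
      (use s True in \<open>auto intro!: derivative_eq_intros\<close>)
  finally have "1 + (\<integral>\<^sup>+y. ennreal (s * exp (s * y)) * indicator {0..} y * indicator {..z} y \<partial>lborel)
      = ennreal 1 + ennreal (exp (s * z) - 1)" by simp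
  also have "\<dots> = ennreal (1 + (exp (s * z) - 1))"
    using True s by (intro ennreal_plus[symmetric]) auto
  finally show ?thesis using True by (simp add: max_absorb2)
next
  case False
  have "(\<integral>\<^sup>+y. ennreal (s * exp (s * y)) * indicator {0..} y * indicator {..z} y \<partial>lborel)
      = (\<integral>\<^sup>+y. 0 \<partial>(lborel :: real measure))"
    by (intro nn_integral_cong) (use False in \<open>auto simp: indicator_def\<close>)
  thus ?thesis using False by (simp add: max_absorb1)
qed

text \<open>
  A layer-cake computation: \<open>E exp (s (u - q)\<^sup>+) = 1 + \<integral>\<^sub>0\<^sup>\<infinity> s exp (s y) F (u - y) dy\<close>. With a tail of rate
  \<open>2 s\<close>, twice the rate of the exponential moment, the integral is at most \<open>p \<integral>\<^sub>0\<^sup>\<infinity> s exp (- s y) dy = p\<close>.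
\<close>

lemma (in real_distribution) excess_mgf_le:
  fixes s u p :: real
  assumes s: "s > 0" and p: "0 \<le> p"
    and tail: "\<And>y. y \<ge> 0 \<Longrightarrow> cdf M (u - y) \<le> p * exp (- (2 * s * y))"
  shows "(\<integral>\<^sup>+q. ennreal (exp (s * max 0 (u - q))) \<partial>M) \<le> ennreal (1 + p)"
proof -
  interpret pair_sigma_finite M "lborel :: real measure" ..
  define f where "f q y = ennreal (s * exp (s * y)) * indicator {0..} y * indicator {..u - q} y" for q y
  have f_meas: "(\<lambda>(q, y). f q y) \<in> borel_measurable (M \<Otimes>\<^sub>M lborel)"
  proof -
    have "(\<lambda>(q, y). f q y) = (\<lambda>w. ennreal (s * exp (s * snd w)) * indicator {0..} (snd w)
        * indicator {w \<in> space (borel \<Otimes>\<^sub>M borel). snd w \<le> u - fst w} w)"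
      by (auto simp: f_def indicator_def space_pair_measure fun_eq_iff)
    also have "\<dots> \<in> borel_measurable (borel \<Otimes>\<^sub>M borel)" by measurable
    also have "borel_measurable (borel \<Otimes>\<^sub>M borel) = borel_measurable (M \<Otimes>\<^sub>M (lborel :: real measure))"
      by (intro measurable_cong_sets sets_pair_measure_cong) auto
    finally show ?thesis .
  qed
  have inner: "(\<integral>\<^sup>+q. f q y \<partial>M)
      = ennreal (s * exp (s * y)) * indicator {0..} y * emeasure M {..u - y}" for y
  proof -
    have "(\<integral>\<^sup>+q. f q y \<partial>M)
       = (\<integral>\<^sup>+q. ennreal (s * exp (s * y)) * indicator {0..} y * indicator {..u - y} q \<partial>M)"
      by (intro nn_integral_cong) (auto simp: f_def indicator_def)
    thus ?thesis by (simp add: nn_integral_cmult)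
  qed
  have "(\<integral>\<^sup>+q. ennreal (exp (s * max 0 (u - q))) \<partial>M) = (\<integral>\<^sup>+q. 1 + (\<integral>\<^sup>+y. f q y \<partial>lborel) \<partial>M)"
    by (simp add: layer_cake_exp[OF s] f_def)
  also have "\<dots> = (\<integral>\<^sup>+q. 1 \<partial>M) + (\<integral>\<^sup>+q. (\<integral>\<^sup>+y. f q y \<partial>lborel) \<partial>M)"
    by (rule nn_integral_add) (use lborel.borel_measurable_nn_integral[OF f_meas] in auto)
  also have "(\<integral>\<^sup>+q. 1 \<partial>M) = 1"
    using emeasure_space_1 by (simp del: space_eq_univ)
  also have "(\<integral>\<^sup>+q. (\<integral>\<^sup>+y. f q y \<partial>lborel) \<partial>M) = (\<integral>\<^sup>+y. (\<integral>\<^sup>+q. f q y \<partial>M) \<partial>lborel)"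
    by (rule Fubini'[symmetric]) (rule f_meas)
  also have "\<dots> \<le> (\<integral>\<^sup>+y. ennreal (p * s * exp (- (s * y))) * indicator {0..} y \<partial>lborel)"
    unfolding inner
  proof (intro nn_integral_mono)
    fix y :: real
    have "ennreal (s * exp (s * y)) * emeasure M {..u - y} \<le> ennreal (p * s * exp (- (s * y)))" if "y \<ge> 0"
    proof -
      have "ennreal (s * exp (s * y)) * emeasure M {..u - y} = ennreal (s * exp (s * y) * cdf M (u - y))"
        using s by (simp add: emeasure_eq_measure cdf_def ennreal_mult')
      also have "\<dots> \<le> ennreal (s * exp (s * y) * (p * exp (- (2 * s * y))))"
        using s tail[OF that] by (intro ennreal_leI mult_left_mono) auto
      also have "s * exp (s * y) * (p * exp (- (2 * s * y))) = p * s * (exp (s * y) * exp (- (2 * s * y)))"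
        by simp
      also have "exp (s * y) * exp (- (2 * s * y)) = exp (- (s * y))"
        by (simp add: mult_exp_exp)
      finally show ?thesis .
    qed
    thus "ennreal (s * exp (s * y)) * indicator {0..} y * emeasure M {..u - y}
       \<le> ennreal (p * s * exp (- (s * y))) * indicator {0..} y"
      by (auto simp: indicator_def)
  qed
  also have "\<dots> = ennreal (0 - (- p * exp (- (s * 0))))"
  proof (rule nn_integral_FTC_atLeast)
    show "((\<lambda>y. - p * exp (- (s * y))) \<longlongrightarrow> 0) at_top"
      using s by real_asymp
  qed (use s p in \<open>auto intro!: derivative_eq_intros\<close>)
  finally have "(\<integral>\<^sup>+q. ennreal (exp (s * max 0 (u - q))) \<partial>M) \<le> ennreal 1 + ennreal p"
    by (simp add: add_left_mono)
  also have "\<dots> = ennreal (1 + p)" using p by (intro ennreal_plus[symmetric]) auto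
  finally show ?thesis .
qed

text \<open>Chernoff's method, with \<open>1 + p \<le> exp p\<close>.\<close>

lemma (in prob_space) iid_excess_tail:
  fixes Y :: "'i \<Rightarrow> 'a \<Rightarrow> real"
  assumes I: "finite I" and ind: "indep_vars (\<lambda>_. borel) Y I"
    and D: "\<And>i. i \<in> I \<Longrightarrow> distr M borel (Y i) = D"
    and s: "s > 0" and p: "p \<ge> 0"
    and mgf: "(\<integral>\<^sup>+q. ennreal (exp (s * max 0 (u - q))) \<partial>D) \<le> ennreal (1 + p)"
  shows "prob {\<omega> \<in> space M. y \<le> (\<Sum>i\<in>I. max 0 (u - Y i \<omega>))} \<le> exp (real (card I) * p - s * y)"
proof -
  have [measurable]: "random_variable borel (Y i)" if "i \<in> I" for i
    using ind that by (auto simp: indep_vars_def)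
  define Z where "Z i \<omega> = ennreal (exp (s * max 0 (u - Y i \<omega>)))" for i \<omega>
  have indZ: "indep_vars (\<lambda>_. borel) Z I"
    unfolding Z_def by (rule indep_vars_compose2[OF ind]) measurable
  have Z: "(\<integral>\<^sup>+\<omega>. Z i \<omega> \<partial>M) \<le> ennreal (1 + p)" if "i \<in> I" for i
  proof -
    have "(\<integral>\<^sup>+\<omega>. Z i \<omega> \<partial>M) = (\<integral>\<^sup>+q. ennreal (exp (s * max 0 (u - q))) \<partial>distr M borel (Y i))"
      unfolding Z_def using that by (subst nn_integral_distr) auto
    thus ?thesis using mgf D[OF that] by simp
  qed
  have meas: "(\<lambda>\<omega>. \<Prod>i\<in>I. Z i \<omega>) \<in> borel_measurable M"
    unfolding Z_def by measurable
  have "emeasure M {\<omega> \<in> space M. y \<le> (\<Sum>i\<in>I. max 0 (u - Y i \<omega>))}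
     = emeasure M {\<omega> \<in> space M. 1 \<le> ennreal (exp (- (s * y))) * (\<Prod>i\<in>I. Z i \<omega>)}"
  proof (intro arg_cong[where f = "emeasure M"] Collect_cong conj_cong refl)
    fix \<omega>
    have "ennreal (exp (- (s * y))) * (\<Prod>i\<in>I. Z i \<omega>)
        = ennreal (exp (s * ((\<Sum>i\<in>I. max 0 (u - Y i \<omega>)) - y)))"
      unfolding Z_def using I
      by (simp add: prod_ennreal ennreal_mult'[symmetric] exp_sum[symmetric] mult_exp_exp sum_distrib_left algebra_simps)
    thus "y \<le> (\<Sum>i\<in>I. max 0 (u - Y i \<omega>)) \<longleftrightarrow> 1 \<le> ennreal (exp (- (s * y))) * (\<Prod>i\<in>I. Z i \<omega>)"
      using s by (simp add: zero_le_mult_iff)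
  qed
  also have "\<dots> \<le> ennreal (exp (- (s * y))) * (\<integral>\<^sup>+\<omega>. (\<Prod>i\<in>I. Z i \<omega>) * indicator (space M) \<omega> \<partial>M)"
    by (rule nn_integral_Markov_inequality) (use meas in auto)
  also have "(\<integral>\<^sup>+\<omega>. (\<Prod>i\<in>I. Z i \<omega>) * indicator (space M) \<omega> \<partial>M) = (\<integral>\<^sup>+\<omega>. (\<Prod>i\<in>I. Z i \<omega>) \<partial>M)"
    by (intro nn_integral_cong) simp
  also have "\<dots> = (\<Prod>i\<in>I. \<integral>\<^sup>+\<omega>. Z i \<omega> \<partial>M)"
    by (rule indep_vars_nn_integral[OF I indZ]) simp
  also have "\<dots> \<le> (\<Prod>i\<in>I. ennreal (exp p))"
  proof (rule prod_mono_ennreal)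
    fix i assume i: "i \<in> I"
    have "ennreal (1 + p) \<le> ennreal (exp p)" by (rule ennreal_leI) (rule exp_ge_add_one_self)
    thus "(\<integral>\<^sup>+\<omega>. Z i \<omega> \<partial>M) \<le> ennreal (exp p)"
      using Z[OF i] by (rule order_trans[rotated])
  qed
  also have "\<dots> = ennreal (exp (real (card I) * p))"
    by (simp add: ennreal_power exp_of_nat_mult[symmetric])
  finally have "emeasure M {\<omega> \<in> space M. y \<le> (\<Sum>i\<in>I. max 0 (u - Y i \<omega>))}
      \<le> ennreal (exp (- (s * y)) * exp (real (card I) * p))"
    by (simp add: ennreal_mult' mult_left_mono)
  thus ?thesis by (simp add: emeasure_eq_measure mult_exp_exp)
qed

lemma (in prob_space) iid_all_gt:
  fixes Y :: "'i \<Rightarrow> 'a \<Rightarrow> real"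
  assumes I: "finite I" "I \<noteq> {}" and ind: "indep_vars (\<lambda>_. borel) Y I"
    and D: "\<And>i. i \<in> I \<Longrightarrow> distr M borel (Y i) = D"
  shows "prob {\<omega> \<in> space M. \<forall>i\<in>I. t < Y i \<omega>} \<le> exp (- (real (card I) * cdf D t))"
proof -
  have rv [measurable]: "random_variable borel (Y i)" if "i \<in> I" for i
    using ind that by (auto simp: indep_vars_def)
  have "{\<omega> \<in> space M. \<forall>i\<in>I. t < Y i \<omega>} = (\<Inter>i\<in>I. Y i -` {t<..} \<inter> space M)"
    using I by auto
  with I have "prob {\<omega> \<in> space M. \<forall>i\<in>I. t < Y i \<omega>} = (\<Prod>i\<in>I. prob (Y i -` {t<..} \<inter> space M))"
    using indep_varsD_finite[OF ind, of "\<lambda>_. {t<..}"] by (simp only:) simp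
  also have "\<dots> \<le> (\<Prod>i\<in>I. exp (- cdf D t))"
  proof (rule prod_mono, safe)
    fix i assume i: "i \<in> I"
    have "cdf D t = prob (Y i -` {..t} \<inter> space M)"
      using i by (simp add: cdf_def D[OF i, symmetric] measure_distr)
    moreover have "prob (Y i -` {t<..} \<inter> space M) = 1 - prob (Y i -` {..t} \<inter> space M)"
      using i by (subst prob_compl[symmetric]) (auto intro!: arg_cong[where f = prob])
    ultimately show "prob (Y i -` {t<..} \<inter> space M) \<le> exp (- cdf D t)"
      using exp_ge_add_one_self[of "- cdf D t"] by simp
  qed simp
  also have "\<dots> = exp (- (real (card I) * cdf D t))"
    by (simp add: exp_of_nat_mult[symmetric])
  finally show ?thesis .
qed

section \<open>Regularity of tails of the form \<open>u\<^sup>a exp (- r u\<^sup>b)\<close>\<close>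

lemma powr_add_ge:
  fixes u y b :: real
  assumes "u > 0" "y \<ge> 0" "b \<ge> 1"
  shows "u powr b + b * u powr (b - 1) * y \<le> (u + y) powr b"
proof (cases "y = 0")
  case False
  have "\<exists>z>u. z < u + y \<and> (u + y) powr b - u powr b = (u + y - u) * (b * z powr (b - 1))"
    by (rule MVT2) (use assms False in \<open>auto intro!: derivative_eq_intros\<close>)
  then obtain z where z: "u < z" "(u + y) powr b - u powr b = y * (b * z powr (b - 1))" by auto
  have "b * u powr (b - 1) * y \<le> b * z powr (b - 1) * y"
    using assms z by (intro mult_right_mono mult_left_mono powr_mono2) auto
  thus ?thesis using z by (simp add: algebra_simps)
qed (use assms in auto)

lemma powr_add_le:
  fixes u y b :: real
  assumes "u > 0" "y \<ge> 0" "b \<ge> 1"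
  shows "(u + y) powr b \<le> u powr b + b * (u + y) powr (b - 1) * y"
proof (cases "y = 0")
  case False
  have "\<exists>z>u. z < u + y \<and> (u + y) powr b - u powr b = (u + y - u) * (b * z powr (b - 1))"
    by (rule MVT2) (use assms False in \<open>auto intro!: derivative_eq_intros\<close>)
  then obtain z where z: "u < z" "z < u + y" "(u + y) powr b - u powr b = y * (b * z powr (b - 1))" by auto
  have "b * z powr (b - 1) * y \<le> b * (u + y) powr (b - 1) * y"
    using assms z by (intro mult_right_mono mult_left_mono powr_mono2) auto
  thus ?thesis using z by (simp add: algebra_simps)
qed (use assms in auto)

text \<open>
  The exponent \<open>r u\<^sup>b\<close> is convex with slope \<open>r b u\<^bsup>b-1\<^esup>\<close> at \<open>u\<close>, so the tail decays from \<open>u\<close> on at least at this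
  rate up to the factor \<open>u\<^sup>a\<close>; the latter changes at relative rate \<open>\<bar>a\<bar> / u\<close>, which is negligible as
  \<open>b > 1\<close>, and a quarter of the slope is given up for it. That leaves \<open>\<rho>\<close>. Conversely, over the distance
  \<open>3 / (2 \<rho> u)\<close>, which is \<open>o(u)\<close>, the slope is asymptotically constant, and the tail loses a factor
  tending to \<open>exp ((3 / 2) / (3 / 4)) = exp 2 < 16\<close>.
\<close>

lemma exp_powr_tail_regular:
  fixes G :: "real \<Rightarrow> real" and a b c r :: real
  assumes b: "b > 1" and c: "c > 0" and r: "r > 0"
    and lim: "((\<lambda>u. G u / (u powr a * exp (- r * u powr b))) \<longlongrightarrow> c) at_top"
  defines "\<rho> \<equiv> \<lambda>u. 3 / 4 * r * b * u powr (b - 1)"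
  shows "\<forall>\<^sub>F u in at_top. (\<forall>y\<ge>0. G (u + y) \<le> 6 / 5 * G u * exp (- (\<rho> u * y)))
           \<and> G u / 16 \<le> G (u + 3 / 2 / \<rho> u)"
proof -
  define L where "L u = G u / (u powr a * exp (- r * u powr b))" for u
  \<comment> \<open>The quotient of two values of \<open>L\<close> in this range lies between \<open>5/6\<close> and \<open>6/5\<close>.\<close>
  have "\<forall>\<^sub>F u in at_top. L u > 10 / 11 * c \<and> L u < 12 / 11 * c \<and> u > 0"
    unfolding L_def
    by (intro eventually_conj order_tendstoD[OF lim] eventually_gt_at_top) (use c in auto)
  then obtain u0 where u0: "\<And>u. u \<ge> u0 \<Longrightarrow> L u > 10 / 11 * c \<and> L u < 12 / 11 * c \<and> u > 0"
    unfolding eventually_at_top_linorder by blast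
  have GL: "G u = L u * (u powr a * exp (- r * u powr b))" if "u \<ge> u0" for u
    using u0[OF that] by (simp add: L_def)
  have small_a: "\<forall>\<^sub>F u in at_top. \<bar>a\<bar> / u \<le> 1 / 4 * r * b * u powr (b - 1)"
    using b r by real_asymp
  have "((\<lambda>u. 3 / 2 / \<rho> u / u) \<longlongrightarrow> 0) at_top"
    unfolding \<rho>_def using b r by real_asymp
  then have lim_low: "((\<lambda>u. 5 / 6 * ((1 + 3 / 2 / \<rho> u / u) powr a
      * exp (- (2 * (1 + 3 / 2 / \<rho> u / u) powr (b - 1))))) \<longlongrightarrow> 5 / 6 * ((1 + 0) powr a * exp (- (2 * (1 + 0) powr (b - 1))))) at_top"
    by (intro tendsto_intros) auto
  have const: "1 / 16 < 5 / 6 * ((1 + 0) powr a * exp (- (2 * (1 + 0) powr (b - 1)))  :: real)"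
  proof -
    have "exp 2 = exp 1 * exp (1::real)" by (simp add: mult_exp_exp)
    also have "\<dots> \<le> 3 * 3" using exp_le by (intro mult_mono) auto
    finally show ?thesis by (simp add: exp_minus field_simps)
  qed
  have "\<forall>\<^sub>F u in at_top. u \<ge> u0 \<and> \<bar>a\<bar> / u \<le> 1 / 4 * r * b * u powr (b - 1) \<and>
     1 / 16 < 5 / 6 * ((1 + 3 / 2 / \<rho> u / u) powr a * exp (- (2 * (1 + 3 / 2 / \<rho> u / u) powr (b - 1))))"
    by (intro eventually_conj eventually_ge_at_top small_a order_tendstoD(1)[OF lim_low const])
  thus ?thesis
  proof eventually_elim
    case (elim u)
    hence uu0: "u \<ge> u0" and u: "u > 0" using u0 by auto
    have rho: "\<rho> u > 0" using b r u by (simp add: \<rho>_def)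
    have L: "L v \<le> 6 / 5 * L w" "L v > 0" if "v \<ge> u0" "w \<ge> u0" for v w
      using u0[OF that(1)] u0[OF that(2)] c by (linarith, simp add: field_simps)
    have up: "G (u + y) \<le> 6 / 5 * G u * exp (- (\<rho> u * y))" if y: "y \<ge> 0" for y
    proof -
      have "u + y = u * (1 + y / u)" using u by (simp add: field_simps)
      hence "(u + y) powr a = u powr a * (1 + y / u) powr a"
        using u y by (simp only: powr_mult)
      also have "(1 + y / u) powr a \<le> exp (\<bar>a\<bar> / u * y)"
      proof -
        have "ln (1 + y / u) \<le> y / u" "ln (1 + y / u) \<ge> 0"
          using u y by (auto intro: ln_add_one_self_le_self)
        hence "a * ln (1 + y / u) \<le> \<bar>a\<bar> * (y / u)"
          by (intro mult_mono) auto
        moreover have "1 + y / u > 0" using u y by (simp add: add_pos_nonneg)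
        ultimately show ?thesis by (simp add: powr_def)
      qed
      also have "exp (\<bar>a\<bar> / u * y) \<le> exp (1 / 4 * r * b * u powr (b - 1) * y)"
        unfolding exp_le_cancel_iff using elim y by (intro mult_right_mono) auto
      finally have pa: "(u + y) powr a \<le> u powr a * exp (1 / 4 * r * b * u powr (b - 1) * y)"
        by (simp add: mult_left_mono)
      have pe: "exp (- r * (u + y) powr b) \<le> exp (- r * u powr b) * exp (- (r * b * u powr (b - 1) * y))"
      proof -
        have "r * (u powr b + b * u powr (b - 1) * y) \<le> r * (u + y) powr b"
          using powr_add_ge[OF u y, of b] b r by (intro mult_left_mono) auto
        thus ?thesis by (simp add: mult_exp_exp algebra_simps)
      qed
      have "G (u + y) = L (u + y) * ((u + y) powr a * exp (- r * (u + y) powr b))"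
        using uu0 y by (intro GL) auto
      also have "\<dots> \<le> 6 / 5 * L u * ((u powr a * exp (1 / 4 * r * b * u powr (b - 1) * y)) *
          (exp (- r * u powr b) * exp (- (r * b * u powr (b - 1) * y))))"
        using uu0 y L(2)[OF uu0 uu0] by (intro mult_mono pa pe L) auto
      also have "\<dots> = 6 / 5 * (L u * (u powr a * exp (- r * u powr b))) *
          (exp (1 / 4 * r * b * u powr (b - 1) * y) * exp (- (r * b * u powr (b - 1) * y)))"
        by (simp only: mult_ac)
      also have "exp (1 / 4 * r * b * u powr (b - 1) * y) * exp (- (r * b * u powr (b - 1) * y))
          = exp (- (\<rho> u * y))"
        by (simp add: mult_exp_exp \<rho>_def field_simps)
      finally show ?thesis using GL[OF uu0] by simp
    qed
    define d where "d = 3 / 2 / \<rho> u"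
    have d: "d > 0" using rho by (simp add: d_def)
    have "u + d = u * (1 + d / u)" using u by (simp add: field_simps)
    hence split: "(u + d) powr p = u powr p * (1 + d / u) powr p" for p
      using u d by (simp only: powr_mult)
    have "r * (u + d) powr b \<le> r * (u powr b + b * (u + d) powr (b - 1) * d)"
      using powr_add_le[of u d b] u d b r by (intro mult_left_mono) auto
    also have "\<dots> = r * u powr b + (r * b * u powr (b - 1) * d) * (1 + d / u) powr (b - 1)"
      unfolding split by (simp add: algebra_simps)
    also have "r * b * u powr (b - 1) * d = 2"
      using b r u by (simp add: d_def \<rho>_def field_simps)
    finally have pe: "exp (- r * (u + d) powr b) \<ge> exp (- r * u powr b) * exp (- (2 * (1 + d / u) powr (b - 1)))"
      by (simp add: mult_exp_exp)
    have "G u / 16 = 1 / 16 * (L u * (u powr a * exp (- r * u powr b)))"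
      using GL[OF uu0] by simp
    also have "\<dots> \<le> (5 / 6 * ((1 + d / u) powr a * exp (- (2 * (1 + d / u) powr (b - 1)))))
        * (L u * (u powr a * exp (- r * u powr b)))"
      using elim L(2)[OF uu0 uu0] by (intro mult_right_mono) (auto simp: d_def)
    also have "\<dots> = 5 / 6 * L u * ((u powr a * (1 + d / u) powr a) *
        (exp (- r * u powr b) * exp (- (2 * (1 + d / u) powr (b - 1)))))"
      by (simp only: mult_ac)
    also have "\<dots> \<le> L (u + d) * ((u + d) powr a * exp (- r * (u + d) powr b))"
      using L[of u "u + d"] L(2)[of "u + d" u] uu0 d pe
      by (intro mult_mono) (auto simp: split)
    also have "\<dots> = G (u + d)" using GL[of "u + d"] uu0 d by simp
    finally show ?case using up by (auto simp: d_def)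
  qed
qed

text \<open>
  The substitution \<open>u = x0 - x\<close> reduces to the centred tail; the shift by \<open>x0\<close> does not affect the
  factor \<open>\<bar>x\<bar>\<^sup>a\<close> asymptotically.
\<close>

lemma cdf_tail_regular:
  fixes F :: "real \<Rightarrow> real" and a x0 b c r \<kappa> :: real
  assumes b: "b > 1" and c: "c > 0" and r: "r > 0" and \<kappa>: "\<kappa> > 0"
    and h: "h \<in> O[at_bot](\<lambda>x::real. \<bar>x\<bar> powr (-\<kappa>))"
    and F: "\<forall>\<^sub>F x in at_bot. F x = (c + h x) * \<bar>x\<bar> powr a * exp (- r * \<bar>x - x0\<bar> powr b)"
  shows "\<forall>\<^sub>F x in at_bot. F x > 0 \<and> (\<exists>\<rho>>0. (\<forall>y\<ge>0. F (x - y) \<le> 6 / 5 * F x * exp (- (\<rho> * y)))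
           \<and> F x / 16 \<le> F (x - 3 / 2 / \<rho>))"
proof -
  define G where "G u = F (x0 - u)" for u
  have bot: "filterlim (\<lambda>u::real. x0 - u) at_bot at_top" by real_asymp
  have "h \<in> o[at_bot](\<lambda>_. 1)"
    by (rule landau_o.big_small_trans[OF h]) (use \<kappa> in real_asymp)
  hence "(h \<longlongrightarrow> 0) at_bot" using smalloD_tendsto by fastforce
  from filterlim_compose[OF this bot] have h0: "((\<lambda>u. h (x0 - u)) \<longlongrightarrow> 0) at_top" .
  have ratio: "((\<lambda>u::real. ((u - x0) / u) powr a) \<longlongrightarrow> 1) at_top"
  proof -
    have "((\<lambda>u::real. (u - x0) / u) \<longlongrightarrow> 1) at_top" by real_asymp
    hence "((\<lambda>u::real. ((u - x0) / u) powr a) \<longlongrightarrow> 1 powr a) at_top"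
      by (intro tendsto_intros) auto
    thus ?thesis by simp
  qed
  have "((\<lambda>u. (c + h (x0 - u)) * ((u - x0) / u) powr a) \<longlongrightarrow> (c + 0) * 1) at_top"
    by (intro tendsto_intros h0 ratio)
  moreover have "\<forall>\<^sub>F u in at_top. (c + h (x0 - u)) * ((u - x0) / u) powr a
      = G u / (u powr a * exp (- r * u powr b))"
    using eventually_compose_filterlim[OF F bot] eventually_gt_at_top[of 0] eventually_gt_at_top[of x0]
    by eventually_elim (simp add: G_def powr_divide)
  ultimately have lim: "((\<lambda>u. G u / (u powr a * exp (- r * u powr b))) \<longlongrightarrow> c) at_top"
    by (auto intro: Lim_transform_eventually)
  have "\<forall>\<^sub>F u in at_top. G u > 0 \<and> (\<exists>\<rho>>0. (\<forall>y\<ge>0. G (u + y) \<le> 6 / 5 * G u * exp (- (\<rho> * y)))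
           \<and> G u / 16 \<le> G (u + 3 / 2 / \<rho>))"
    using exp_powr_tail_regular[OF b c r lim] order_tendstoD(1)[OF lim c] eventually_gt_at_top[of 0]
  proof eventually_elim
    case (elim u)
    have "3 / 4 * r * b * u powr (b - 1) > 0" using b r elim by simp
    moreover have "u powr a * exp (- r * u powr b) > 0" using elim by simp
    hence "G u > 0" using elim(2) by (metis zero_less_divide_iff order_less_asym)
    ultimately show ?case using elim(1) by blast
  qed
  moreover have "filterlim (\<lambda>x::real. x0 - x) at_top at_bot" by real_asymp
  ultimately have "\<forall>\<^sub>F x in at_bot. G (x0 - x) > 0 \<and> (\<exists>\<rho>>0. (\<forall>y\<ge>0. G (x0 - x + y) \<le> 6 / 5 * G (x0 - x) * exp (- (\<rho> * y)))
           \<and> G (x0 - x) / 16 \<le> G (x0 - x + 3 / 2 / \<rho>))"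
    by (rule eventually_compose_filterlim)
  thus ?thesis by (simp add: G_def algebra_simps)
qed

section \<open>The tail of the support size\<close>

text \<open>
  Let \<open>t = u - 3 / (2 \<rho>)\<close>. Either all diagonal entries exceed \<open>t\<close>, or one of the \<open>n\<close> columns has an excess of at
  least \<open>(k - 1) (u - t)\<close> below \<open>u\<close>. The first event has probability at most \<open>exp (- n F t)\<close>, and
  \<open>n F t \<ge> n F u / 16 = k / 32\<close>. For the second, the Chernoff bound at \<open>s = \<rho> / 2\<close> has an exponent of at most
  \<open>n (6/5) F u - s (k - 1) (u - t) = (3/5) k - (3/4) (k - 1)\<close>.
\<close>

lemma (in prob_space) support_size_tail:
  fixes D :: "real measure" and Q :: "nat \<Rightarrow> nat \<Rightarrow> 'a \<Rightarrow> real"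
  assumes n: "n \<ge> 1" and D: "real_distribution D"
    and iid: "iid_symmetric_matrix M D n Q" and X: "random_minimizer M n Q X"
    and u: "cdf D u = real k / (2 * real n)" and \<rho>: "\<rho> > 0"
    and up: "\<And>y. y \<ge> 0 \<Longrightarrow> cdf D (u - y) \<le> 6 / 5 * cdf D u * exp (- (\<rho> * y))"
    and low: "cdf D u / 16 \<le> cdf D (u - 3 / 2 / \<rho>)"
  shows "prob {\<omega> \<in> space M. support_size n (X \<omega>) \<ge> k}
           \<le> exp (- (real k / 32)) + real n * exp (3 / 5 * real k - 3 / 4 * (real k - 1))"
proof -
  define t where "t = u - 3 / 2 / \<rho>"
  define P where "P = {(i, j). 1 \<le> i \<and> i \<le> j \<and> j \<le> n}"
  define Y where "Y = (\<lambda>(i, j). Q i j)"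
  have ind: "indep_vars (\<lambda>_. borel) Y P"
    and dist: "\<And>p. p \<in> P \<Longrightarrow> distr M borel (Y p) = D"
    and sym: "\<And>\<omega> i j. \<omega> \<in> space M \<Longrightarrow> i \<in> {1..n} \<Longrightarrow> j \<in> {1..n} \<Longrightarrow> Q i j \<omega> = Q j i \<omega>"
    using iid by (auto simp: iid_symmetric_matrix_def Y_def P_def)
  have rv: "random_variable borel (Y p)" if "p \<in> P" for p
    using ind that by (auto simp: indep_vars_def)
  define Dg where "Dg = (\<lambda>i::nat. (i, i)) ` {1..n}"
  \<comment> \<open>Independence is given for the entries on or above the diagonal, so column \<open>j\<close> is reflected into
    that triangle.\<close>
  define entry where "entry j i = (min i j, max i j)" for i j :: nat
  define Col where "Col j = entry j ` ({1..n} - {j})" for j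
  have Dg: "Dg \<subseteq> P" "finite Dg" "Dg \<noteq> {}" "card Dg = n"
    using n by (auto simp: Dg_def P_def card_image inj_on_def)
  have inj: "inj_on (entry j) ({1..n} - {j})" for j
    by (auto simp: inj_on_def entry_def min_def max_def split: if_splits)
  have Col: "Col j \<subseteq> P" "finite (Col j)" "card (Col j) \<le> n" if "j \<in> {1..n}" for j
    using that card_image[OF inj, of j] by (auto simp: Col_def P_def entry_def)
  define E0 where "E0 = {\<omega> \<in> space M. \<forall>p\<in>Dg. t < Y p \<omega>}"
  define E where "E j = {\<omega> \<in> space M. (real k - 1) * (u - t) \<le> (\<Sum>p\<in>Col j. max 0 (u - Y p \<omega>))}" for j
  have E0_ev: "E0 \<in> events"
  proof -
    have "{\<omega> \<in> space M. t < Y p \<omega>} \<in> events" if "p \<in> Dg" for p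
    proof -
      have [measurable]: "random_variable borel (Y p)" by (rule rv[OF subsetD[OF Dg(1) that]])
      show ?thesis by measurable
    qed
    thus ?thesis unfolding E0_def using Dg by (intro sets.sets_Collect_finite_All) auto
  qed
  have E_ev: "E j \<in> events" if "j \<in> {1..n}" for j
  proof -
    have "(\<lambda>\<omega>. \<Sum>p\<in>Col j. max 0 (u - Y p \<omega>)) \<in> borel_measurable M"
      using rv Col[OF that] by (intro borel_measurable_sum borel_measurable_max borel_measurable_diff) auto
    thus ?thesis unfolding E_def by measurable
  qed
  have cover: "{\<omega> \<in> space M. support_size n (X \<omega>) \<ge> k} \<subseteq> E0 \<union> (\<Union>j\<in>{1..n}. E j)"
  proof
    fix \<omega> assume "\<omega> \<in> {\<omega> \<in> space M. support_size n (X \<omega>) \<ge> k}"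
    hence \<omega>: "\<omega> \<in> space M" and supp: "k \<le> support_size n (X \<omega>)" by auto
    show "\<omega> \<in> E0 \<union> (\<Union>j\<in>{1..n}. E j)"
    proof (cases "\<omega> \<in> E0")
      case False
      then obtain l where l: "l \<in> {1..n}" "Q l l \<omega> \<le> t"
        using \<omega> by (auto simp: E0_def Dg_def Y_def not_less)
      have minim: "StQP_minimizer n (\<lambda>i j. Q i j \<omega>) (X \<omega>)"
        using X \<omega> by (auto simp: random_minimizer_def)
      then obtain j where j: "j \<in> {1..n}"
        "(real k - 1) * (u - t) \<le> (\<Sum>i\<in>{1..n} - {j}. max 0 (u - Q i j \<omega>))"
        using minimizer_column_excess[where A = "\<lambda>i j. Q i j \<omega>", OF minim sym[OF \<omega>] supp l, of u] \<rho> by (auto simp: t_def)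
      have "(\<Sum>i\<in>{1..n} - {j}. max 0 (u - Q i j \<omega>)) = (\<Sum>p\<in>Col j. max 0 (u - Y p \<omega>))"
        unfolding Col_def sum.reindex[OF inj] o_def
        by (intro sum.cong refl arg_cong2[where f = max] arg_cong2[where f = minus])
          (use j(1) sym[OF \<omega>] in \<open>auto simp: Y_def entry_def min_def max_def\<close>)
      thus ?thesis using j \<omega> by (auto simp: E_def)
    qed auto
  qed
  have column: "prob (E j) \<le> exp (3 / 5 * real k - 3 / 4 * (real k - 1))" if j: "j \<in> {1..n}" for j
  proof -
    define p where "p = 3 / 5 * real k / real n"
    have pu: "6 / 5 * cdf D u = p" by (simp add: u p_def)
    have mgf: "(\<integral>\<^sup>+q. ennreal (exp (\<rho> / 2 * max 0 (u - q))) \<partial>D) \<le> ennreal (1 + p)"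
    proof (rule real_distribution.excess_mgf_le[OF D])
      show "cdf D (u - y) \<le> p * exp (- (2 * (\<rho> / 2) * y))" if "y \<ge> 0" for y
        using up[OF that] unfolding pu by simp
    qed (use \<rho> in \<open>simp_all add: p_def\<close>)
    have "prob (E j) \<le> exp (real (card (Col j)) * p - \<rho> / 2 * ((real k - 1) * (u - t)))"
      unfolding E_def
      by (rule iid_excess_tail[OF Col(2)[OF j] indep_vars_subset[OF ind Col(1)[OF j]] _ _ _ mgf])
        (use dist Col(1)[OF j] \<rho> in \<open>auto simp: p_def\<close>)
    also have "real (card (Col j)) * p \<le> real n * p"
      using Col(3)[OF j] by (intro mult_right_mono) (auto simp: p_def)
    also have "real n * p = 3 / 5 * real k" using n by (simp add: p_def)
    also have "\<rho> / 2 * ((real k - 1) * (u - t)) = 3 / 4 * (real k - 1)"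
      using \<rho> by (simp add: t_def)
    finally show ?thesis by simp
  qed
  have diag: "prob E0 \<le> exp (- (real k / 32))"
  proof -
    have "prob E0 \<le> exp (- (real (card Dg) * cdf D t))"
      unfolding E0_def
      by (rule iid_all_gt[OF Dg(2,3) indep_vars_subset[OF ind Dg(1)]]) (use dist Dg in auto)
    also have "real k / 32 \<le> real (card Dg) * cdf D t"
      using low n mult_left_mono[OF low, of "real n"] by (simp add: Dg u t_def)
    hence "exp (- (real (card Dg) * cdf D t)) \<le> exp (- (real k / 32))" by simp
    finally show ?thesis .
  qed
  have "prob {\<omega> \<in> space M. support_size n (X \<omega>) \<ge> k} \<le> prob (E0 \<union> (\<Union>j\<in>{1..n}. E j))"
    by (rule finite_measure_mono[OF cover]) (use E0_ev E_ev in auto)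
  also have "\<dots> \<le> prob E0 + prob (\<Union>j\<in>{1..n}. E j)"
    by (rule measure_Un_le) (use E0_ev E_ev in auto)
  also have "prob (\<Union>j\<in>{1..n}. E j) \<le> (\<Sum>j=1..n. prob (E j))"
    by (rule measure_UNION_le) (use E_ev in auto)
  also have "\<dots> \<le> (\<Sum>j=1..n. exp (3 / 5 * real k - 3 / 4 * (real k - 1)))"
    by (rule sum_mono) (rule column)
  finally show ?thesis using diag by simp
qed

text \<open>Up to an additive constant both exponents are at most \<open>- k / 32\<close>, and \<open>exp (- 1 / 8) \<le> 8 / 9\<close>.\<close>

lemma support_size_tail_bound_le:
  fixes n k :: nat
  assumes "n \<ge> 1"
  shows "exp (- (real k / 32)) + real n * exp (3 / 5 * real k - 3 / 4 * (real k - 1))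
     \<le> 4 * real n * (8 / 9) powr (real k / 4)"
proof -
  have "ln (9 / 8 :: real) \<le> 1 / 8" using ln_add_one_self_le_self[of "1/8"] by simp
  hence "real k / 4 * ln (9 / 8) \<le> real k / 4 * (1 / 8)" by (intro mult_left_mono) auto
  hence theta: "exp (- (real k / 32)) \<le> (8 / 9) powr (real k / 4)"
    by (simp add: powr_def ln_div algebra_simps)
  have "3 / 5 * real k - 3 / 4 * (real k - 1) \<le> 1 + - (real k / 32)"
    by (simp add: field_simps)
  hence "exp (3 / 5 * real k - 3 / 4 * (real k - 1)) \<le> exp (1 + - (real k / 32))" by simp
  also have "\<dots> \<le> 3 * exp (- (real k / 32))"
    unfolding exp_add using exp_le by (intro mult_right_mono) auto
  finally have "real n * exp (3 / 5 * real k - 3 / 4 * (real k - 1)) \<le> real n * (3 * exp (- (real k / 32)))"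
    by (intro mult_left_mono) auto
  moreover have "exp (- (real k / 32)) \<le> real n * exp (- (real k / 32))" using assms by simp
  ultimately have "exp (- (real k / 32)) + real n * exp (3 / 5 * real k - 3 / 4 * (real k - 1))
      \<le> 4 * real n * exp (- (real k / 32))" by linarith
  also have "\<dots> \<le> 4 * real n * (8 / 9) powr (real k / 4)"
    using theta by (intro mult_left_mono) auto
  finally show ?thesis .
qed

section \<open>Small values of the distribution function and measurability\<close>

lemma k_max_over_n_tendsto_0:
  assumes "\<alpha> > 0" shows "(\<lambda>n. real (k_max \<alpha> n) / (2 * real n)) \<longlonglongrightarrow> 0"
proof (rule tendsto_sandwich[where f = "\<lambda>_. 0" and h = "\<lambda>n. (\<alpha> * sqrt (real n) + 1) / (2 * real n)"])
  have "real (k_max \<alpha> n) \<le> \<alpha> * sqrt (real n) + 1" for n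
    using assms by (simp add: k_max_def)
  thus "\<forall>\<^sub>F n in sequentially. real (k_max \<alpha> n) / (2 * real n) \<le> (\<alpha> * sqrt (real n) + 1) / (2 * real n)"
    by (intro always_eventually allI divide_right_mono) auto
  show "(\<lambda>n. (\<alpha> * sqrt (real n) + 1) / (2 * real n)) \<longlonglongrightarrow> 0"
    using assms by real_asymp
qed auto

lemma (in real_distribution) cdf_attains_small_values:
  assumes cont: "continuous_on UNIV (cdf M)" and v: "0 < v" "v \<le> cdf M x"
  obtains u where "u \<le> x" "cdf M u = v"
proof -
  have "\<forall>\<^sub>F z in at_bot. cdf M z < v \<and> z \<le> x"
    by (intro eventually_conj order_tendstoD(2)[OF cdf_lim_at_bot v(1)] eventually_le_at_bot)
  then obtain z where "cdf M z < v" "z \<le> x"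
    using eventually_happens trivial_limit_at_bot_linorder by blast
  then obtain u where "z \<le> u" "u \<le> x" "cdf M u = v"
    using IVT'[of "cdf M" z v x] v continuous_on_subset[OF cont] by auto
  thus thesis using that by blast
qed

lemma support_size_measurable:
  assumes X: "random_minimizer M n Q X"
  shows "{\<omega> \<in> space M. support_size n (X \<omega>) \<ge> k} \<in> sets M"
proof -
  have X': "X \<in> M \<rightarrow>\<^sub>M (\<Pi>\<^sub>M j\<in>{1..n}. borel)" using X by (simp add: random_minimizer_def)
  have comp: "(\<lambda>\<omega>. X \<omega> j) \<in> borel_measurable M" if "j \<in> {1..n}" for j
    using measurable_compose[OF X' measurable_component_singleton[OF that]] .
  have "real (support_size n x) = (\<Sum>j=1..n. if x j > 0 then 1 else 0)" for x
    by (simp add: support_size_def sum.If_cases Int_def)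
  hence "{\<omega> \<in> space M. support_size n (X \<omega>) \<ge> k}
      = {\<omega> \<in> space M. real k \<le> (\<Sum>j=1..n. if X \<omega> j > 0 then 1 else 0)}"
    by (metis of_nat_le_iff)
  moreover have "(\<lambda>\<omega>. \<Sum>j=1..n. if X \<omega> j > 0 then 1 else 0 :: real) \<in> borel_measurable M"
    using comp by (intro borel_measurable_sum measurable_If) (auto intro!: borel_measurable_less)
  ultimately show ?thesis by simp
qed

section \<open>Boundedness in probability and the conclusion\<close>

text \<open>
  At \<open>k = \<lceil>80 log n\<rceil>\<close> the tail bound is at most \<open>C / n\<close>, as \<open>20 log (9 / 8) \<ge> 20 / 9 \<ge> 2\<close>; and \<open>w n * g n\<close>
  is eventually at least \<open>80 log n\<close> because \<open>w\<close> tends to infinity and \<open>g n\<close> is eventually at least \<open>log n\<close>.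
\<close>

lemma bigo_in_prob_ln_of_exponential_tail:
  fixes M :: "nat \<Rightarrow> 'w measure" and K :: "nat \<Rightarrow> 'w \<Rightarrow> nat" and g :: "nat \<Rightarrow> real"
  assumes prob: "\<And>n. n \<ge> 1 \<Longrightarrow> prob_space (M n)"
    and meas: "\<And>n k. n \<ge> 1 \<Longrightarrow> {\<omega> \<in> space (M n). K n \<omega> \<ge> k} \<in> sets (M n)"
    and tail: "\<forall>\<^sub>F n in sequentially. \<forall>k. 1 \<le> k \<and> k \<le> k_max \<alpha> n \<longrightarrow>
        measure (M n) {\<omega> \<in> space (M n). K n \<omega> \<ge> k} \<le> C * real n * (8 / 9) powr (real k / 4)"
    and C: "C \<ge> 0" and \<alpha>: "\<alpha> > 0"
    and g: "\<forall>\<^sub>F n in sequentially. ln (real n) \<le> g n"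
  shows "bigo_in_prob M K g"
  unfolding bigo_in_prob_def
proof (intro allI impI)
  fix w :: "nat \<Rightarrow> real" assume w: "filterlim w at_top sequentially"
  define k where "k n = nat \<lceil>80 * ln (real n)\<rceil>" for n :: nat
  have ev: "\<forall>\<^sub>F n in sequentially. 80 * ln (real n) \<le> \<alpha> * sqrt (real n) \<and> w n \<ge> 80 \<and> n \<ge> 2"
  proof (intro eventually_conj eventually_ge_at_top)
    show "\<forall>\<^sub>F n in sequentially. 80 * ln (real n) \<le> \<alpha> * sqrt (real n)"
      using \<alpha> by real_asymp
    show "\<forall>\<^sub>F n in sequentially. w n \<ge> 80"
      using w by (auto simp: filterlim_at_top)
  qed
  have "\<forall>\<^sub>F n in sequentially. measure (M n) {\<omega> \<in> space (M n). real (K n \<omega>) > w n * g n} \<le> C / real n"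
    using ev tail g
  proof eventually_elim
    case (elim n)
    interpret prob_space "M n" using prob elim by simp
    have ln: "ln (real n) > 0" using elim by simp
    have k: "1 \<le> k n" "real (k n) \<ge> 80 * ln (real n)"
      using ln by (auto simp: k_def Suc_le_eq real_nat_ceiling_ge)
    have k_le: "k n \<le> k_max \<alpha> n"
      unfolding k_def k_max_def using elim by (intro nat_mono ceiling_mono) auto
    have "80 * ln (real n) \<le> w n * g n" using elim ln by (intro mult_mono) auto
    hence "prob {\<omega> \<in> space (M n). real (K n \<omega>) > w n * g n} \<le> prob {\<omega> \<in> space (M n). K n \<omega> \<ge> k n}"
      using elim by (intro finite_measure_mono meas) (auto simp: k_def nat_le_iff ceiling_le_iff)
    also have "\<dots> \<le> C * real n * (8 / 9) powr (real (k n) / 4)"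
      using elim k k_le by blast
    also have "(8 / 9) powr (real (k n) / 4) \<le> exp (- (2 * ln (real n)))"
    proof -
      have "(1 / 9 :: real) \<le> ln (9 / 8)"
        using ln_le_minus_one[of "8 / 9 :: real"] by (simp add: ln_div)
      hence "20 * ln (real n) * (1 / 9) \<le> real (k n) / 4 * ln (9 / 8)"
        using k(2) ln by (intro mult_mono) auto
      hence "2 * ln (real n) \<le> real (k n) / 4 * ln (9 / 8)" using ln by simp
      also have "ln (9 / 8 :: real) = - ln (8 / 9)" by (simp add: ln_div)
      finally show ?thesis by (simp add: powr_def)
    qed
    also have "exp (- (2 * ln (real n))) = 1 / real n ^ 2"
      using elim exp_of_nat_mult[of 2 "ln (real n)"] by (simp add: exp_minus field_simps)
    finally show ?case using elim C by (simp add: power2_eq_square mult_left_mono)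
  qed
  moreover have "(\<lambda>n. C / real n) \<longlonglongrightarrow> 0" by real_asymp
  ultimately show "(\<lambda>n. measure (M n) {\<omega> \<in> space (M n). real (K n \<omega>) > w n * g n}) \<longlonglongrightarrow> 0"
    by (rule tendsto_sandwich[OF always_eventually _ tendsto_const, rotated]) simp
qed

theorem theorem1p3:
  fixes D :: "real measure" and B :: ereal
    and a x0 b c r \<kappa> \<alpha> :: real
    and M :: "nat \<Rightarrow> 'w measure"
    and Q :: "nat \<Rightarrow> nat \<Rightarrow> nat \<Rightarrow> 'w \<Rightarrow> real"
    and X :: "nat \<Rightarrow> 'w \<Rightarrow> nat \<Rightarrow> real"
  assumes "real_distribution D"
    and "continuous_on UNIV (cdf D)"
    and "AE x in D. ereal x < B"
    and "b > 0" "c > 0" "r > 0" "\<kappa> > 0"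
    and "\<exists>h \<in> O[at_bot](\<lambda>x::real. \<bar>x\<bar> powr (-\<kappa>)). \<forall>\<^sub>F x in at_bot.
           cdf D x = (c + h x) * \<bar>x\<bar> powr a * exp (- r * \<bar>x - x0\<bar> powr b)"
    and "b > 1"
    and "\<alpha> > exp 1 * sqrt 2"
    and "\<And>n. n \<ge> 1 \<Longrightarrow> prob_space (M n)"
    and "\<And>n. n \<ge> 1 \<Longrightarrow> iid_symmetric_matrix (M n) D n (Q n)"
    and "\<And>n. n \<ge> 1 \<Longrightarrow> random_minimizer (M n) n (Q n) (X n)"
  shows "(\<exists>C::real. \<forall>\<^sub>F n in sequentially. \<forall>k::nat. 1 \<le> k \<and> k \<le> k_max \<alpha> n \<longrightarrow>
            measure (M n) {\<omega> \<in> space (M n). support_size n (X n \<omega>) \<ge> k}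
              \<le> C * (real n * (8 / 9) powr (real k / 4)
                     + real n * exp (- (real k * ln (real n / real k) powr min 0 (a / b))
                                       / (2 * exp 1))))
       \<and> (a \<ge> 0 \<longrightarrow>
            bigo_in_prob M (\<lambda>n \<omega>. support_size n (X n \<omega>)) (\<lambda>n. ln (real n)))
       \<and> (a < 0 \<longrightarrow>
            bigo_in_prob M (\<lambda>n \<omega>. support_size n (X n \<omega>))
              (\<lambda>n. ln (real n) powr (1 + \<bar>a\<bar> / b)))"
proof -
  let ?tail = "\<lambda>n k. measure (M n) {\<omega> \<in> space (M n). support_size n (X n \<omega>) \<ge> k}"
  interpret D: real_distribution D by fact
  have \<alpha>: "\<alpha> > 0" using assms(10) by (rule order.strict_trans1[rotated]) simp
  obtain h where h: "h \<in> O[at_bot](\<lambda>x::real. \<bar>x\<bar> powr (-\<kappa>))"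
    "\<forall>\<^sub>F x in at_bot. cdf D x = (c + h x) * \<bar>x\<bar> powr a * exp (- r * \<bar>x - x0\<bar> powr b)"
    using assms(8) by blast
  \<comment> \<open>As \<open>k / (2 n)\<close> is uniformly small for \<open>k \<le> k_max \<alpha> n\<close>, the level \<open>u\<close> with \<open>F u = k / (2 n)\<close> can be
    found to the left of \<open>x1\<close>, where the tail is regular.\<close>
  obtain x1 where x1: "\<And>x. x \<le> x1 \<Longrightarrow> cdf D x > 0 \<and>
      (\<exists>\<rho>>0. (\<forall>y\<ge>0. cdf D (x - y) \<le> 6 / 5 * cdf D x * exp (- (\<rho> * y)))
        \<and> cdf D x / 16 \<le> cdf D (x - 3 / 2 / \<rho>))"
    using cdf_tail_regular[OF \<open>b > 1\<close> \<open>c > 0\<close> \<open>r > 0\<close> \<open>\<kappa> > 0\<close> h]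
    unfolding eventually_at_bot_linorder by blast
  have "\<forall>\<^sub>F n in sequentially. real (k_max \<alpha> n) / (2 * real n) < cdf D x1 \<and> n \<ge> 1"
    by (intro eventually_conj eventually_ge_at_top order_tendstoD(2)[OF k_max_over_n_tendsto_0[OF \<alpha>]])
      (use x1 in auto)
  hence tail: "\<forall>\<^sub>F n in sequentially. \<forall>k. 1 \<le> k \<and> k \<le> k_max \<alpha> n \<longrightarrow>
      ?tail n k \<le> 4 * real n * (8 / 9) powr (real k / 4)"
  proof (eventually_elim, safe)
    fix n k :: nat
    assume n: "real (k_max \<alpha> n) / (2 * real n) < cdf D x1" "1 \<le> n" and k: "1 \<le> k" "k \<le> k_max \<alpha> n"
    interpret prob_space "M n" using assms(11) n by simp
    have "real k / (2 * real n) \<le> real (k_max \<alpha> n) / (2 * real n)"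
      using k by (intro divide_right_mono) auto
    then obtain u where u: "u \<le> x1" "cdf D u = real k / (2 * real n)"
      using D.cdf_attains_small_values[OF assms(2), of "real k / (2 * real n)" x1] n k by auto
    from x1[OF u(1)] obtain \<rho> where "\<rho> > 0"
      "\<And>y. y \<ge> 0 \<Longrightarrow> cdf D (u - y) \<le> 6 / 5 * cdf D u * exp (- (\<rho> * y))"
      "cdf D u / 16 \<le> cdf D (u - 3 / 2 / \<rho>)" by blast
    from support_size_tail[OF n(2) assms(1) assms(12)[OF n(2)] assms(13)[OF n(2)] u(2) this]
      support_size_tail_bound_le[OF n(2), of k]
    show "?tail n k \<le> 4 * real n * (8 / 9) powr (real k / 4)" by linarith
  qed
  have "\<exists>C::real. \<forall>\<^sub>F n in sequentially. \<forall>k::nat. 1 \<le> k \<and> k \<le> k_max \<alpha> n \<longrightarrow>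
      ?tail n k \<le> C * (real n * (8 / 9) powr (real k / 4)
        + real n * exp (- (real k * ln (real n / real k) powr min 0 (a / b)) / (2 * exp 1)))"
    using tail by (intro exI[of _ 4]) (auto elim!: eventually_mono simp: algebra_simps intro: add_increasing2)
  note bound = this
  have Op: "bigo_in_prob M (\<lambda>n \<omega>. support_size n (X n \<omega>)) g"
    if "\<forall>\<^sub>F n in sequentially. ln (real n) \<le> g n" for g
    by (rule bigo_in_prob_ln_of_exponential_tail[OF assms(11) support_size_measurable[OF assms(13)] tail _ \<alpha> that]) auto
  have log_le: "\<forall>\<^sub>F n in sequentially. ln (real n) \<le> ln (real n) powr (1 + \<bar>a\<bar> / b)"
    using eventually_ge_at_top[of 3]
  proof eventually_elim
    case (elim n)
    have "exp 1 \<le> real n" using exp_le elim by (intro order_trans[OF exp_le]) auto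
    hence "1 \<le> ln (real n)" using elim by (simp add: ln_ge_iff)
    hence "ln (real n) powr 1 \<le> ln (real n) powr (1 + \<bar>a\<bar> / b)"
      using \<open>b > 0\<close> by (intro powr_mono) auto
    thus ?case using \<open>1 \<le> ln (real n)\<close> by simp
  qed
  show ?thesis using bound Op[of "\<lambda>n. ln (real n)"] Op[OF log_le] by (simp only: order_refl eventually_True) blast
qed

end
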